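(* Let $G$ be a finite simple semi-transitively orientable graph and let $e$ be an edge of $G$. If no subgraph of $G$ isomorphic to $K_4$ contains $e$, then the graph $G\setminus e$ obtained by deleting $e$ is semi-transitively orientable, and every graph obtained from $G$ by subdividing $e$ (i.e. replacing $e$ with a path of length at least $2$) is semi-transitively orientable.
   Context: Graphs are finite, undirected and simple. An orientation of a graph assigns to each edge one of its two directions; it is acyclic if it has no directed cycle. A digraph is transitive if whenever $v_1\to v_2$ and $v_2\to v_3$ are directed edges on three distinct vertices, $v_1\to v_3$ is also a directed edge. Given an acyclic orientation $\phi$ of a graph $G$, a shortcut in $\phi(G)$ is a non-transitive induced subdigraph of $\phi(G)$ on a vertex set $\{v_1,\dots,v_n\}$ with $n\ge 4$ (distinct vertices) that contains the directed path $v_1\to v_2\to\cdots\to v_n$ and the directed edge $v_1\to v_n$. An acyclic orientation $\phi$ is semi-transitive if $\phi(G)$ contains no shortcut, and a graph is semi-transitively orientable if it has a semi-transitive orientation. $G\setminus e$ denotes $G$ with the edge $e$ deleted (keeping all vertices). Subdividing $e=xy$ means deleting $e$ and adding a path $x,p_1,\dots,p_t,y$ with $t\ge 1$, where $p_1,\dots,p_t$ are new vertices. *)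

theory Defs
  imports "Graph_Theory.Graph_Theory"
begin

text \<open>
  A finite simple graph is a \<open>pair_graph\<close>: a finite loopfree symmetric relation \<open>parcs G\<close> on
  \<open>pverts G\<close>. An undirected edge \<open>xy\<close> is the pair of opposite arcs \<open>(x, y)\<close>, \<open>(y, x)\<close> and is
  referred to by either of them.
\<close>

definition orientation :: "'a pair_pre_digraph \<Rightarrow> 'a pair_pre_digraph \<Rightarrow> bool" where
  "orientation D G \<longleftrightarrow>
     pverts D = pverts G \<and> parcs D \<subseteq> parcs G \<and>
     (\<forall>u v. (u, v) \<in> parcs G \<longrightarrow> ((u, v) \<in> parcs D \<longleftrightarrow> (v, u) \<notin> parcs D))"

definition acyclic_orientation :: "'a pair_pre_digraph \<Rightarrow> 'a pair_pre_digraph \<Rightarrow> bool" where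
  "acyclic_orientation D G \<longleftrightarrow> orientation D G \<and> \<not> (\<exists>p. pre_digraph.cycle D p)"

definition transitive_digraph :: "'a pair_pre_digraph \<Rightarrow> bool" where
  "transitive_digraph D \<longleftrightarrow>
     (\<forall>u v w. distinct [u, v, w] \<and> u \<rightarrow>\<^bsub>D\<^esub> v \<and> v \<rightarrow>\<^bsub>D\<^esub> w \<longrightarrow> u \<rightarrow>\<^bsub>D\<^esub> w)"

definition shortcut :: "'a pair_pre_digraph \<Rightarrow> 'a pair_pre_digraph \<Rightarrow> bool" where
  "shortcut S D \<longleftrightarrow>
     induced_subgraph S D \<and> \<not> transitive_digraph S \<and>
     (\<exists>vs. 4 \<le> length vs \<and> pverts S = set vs \<and> vpath vs S \<and> hd vs \<rightarrow>\<^bsub>S\<^esub> last vs)"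

definition semi_transitive_orientation :: "'a pair_pre_digraph \<Rightarrow> 'a pair_pre_digraph \<Rightarrow> bool" where
  "semi_transitive_orientation D G \<longleftrightarrow> acyclic_orientation D G \<and> \<not> (\<exists>S. shortcut S D)"

definition semi_transitively_orientable :: "'a pair_pre_digraph \<Rightarrow> bool" where
  "semi_transitively_orientable G \<longleftrightarrow> (\<exists>D. semi_transitive_orientation D G)"

definition delete_edge :: "'a pair_pre_digraph \<Rightarrow> 'a \<times> 'a \<Rightarrow> 'a pair_pre_digraph" where
  "delete_edge G e = \<lparr> pverts = pverts G, parcs = parcs G - {(fst e, snd e), (snd e, fst e)} \<rparr>"

text \<open>
  The list \<open>ps\<close> consists of the inner vertices of the path that replaces the edge.
\<close>

definition subdivides_edge ::
    "'a pair_pre_digraph \<Rightarrow> 'a \<times> 'a \<Rightarrow> 'a pair_pre_digraph \<Rightarrow> bool" where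
  "subdivides_edge G e H \<longleftrightarrow>
     (\<exists>ps. ps \<noteq> [] \<and> distinct ps \<and> set ps \<inter> pverts G = {} \<and>
        (let P = set (vwalk_arcs (fst e # ps @ [snd e])) in
           H = \<lparr> pverts = pverts G \<union> set ps, parcs = parcs (delete_edge G e) \<union> P \<union> P\<inverse> \<rparr>))"

end

theory Submission
  imports Defs
begin

text \<open>
  Fix a semi-transitive orientation with \<open>x \<rightarrow> y\<close> for the edge \<open>e = xy\<close>. In such an orientation a
  directed path on at least four vertices whose ends are joined by an arc spans a transitive
  tournament, so no such path meets both \<open>x\<close> and \<open>y\<close> if \<open>e\<close> lies in no \<open>K\<^sub>4\<close>. Hence simply dropping
  the arc \<open>x \<rightarrow> y\<close> creates no shortcut.

  For a subdivision with one new vertex \<open>p\<close>: if there is a directed path \<open>x \<rightarrow> z \<rightarrow> y\<close>, orient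
  \<open>x \<rightarrow> p \<rightarrow> y\<close>; otherwise orient \<open>x \<rightarrow> p \<leftarrow> y\<close>. A shortcut through \<open>p\<close> would come from a path as above
  through \<open>x\<close> and \<open>y\<close> on at least four vertices, or from a triangle on \<open>e\<close> of a kind that the choice
  excludes. A path with more inner vertices arises by subdividing the edge \<open>py\<close> again, which lies in
  no triangle.
\<close>

section \<open>Shortcut-free relations\<close>

abbreviation path_in :: "'a rel \<Rightarrow> 'a list \<Rightarrow> bool" where
  "path_in E \<equiv> successively (\<lambda>u v. (u, v) \<in> E)"

abbreviation tournament_in :: "'a rel \<Rightarrow> 'a list \<Rightarrow> bool" where
  "tournament_in E \<equiv> sorted_wrt (\<lambda>u v. (u, v) \<in> E)"

text \<open>This is meant for acyclic \<open>E\<close>. There every path is repetition-free, and the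
  subdigraph induced on the vertices of a path is transitive exactly when all forward pairs along
  the path are arcs. Shortcuts thus turn into a condition on lists alone.\<close>

definition shortcut_free :: "'a rel \<Rightarrow> bool" where
  "shortcut_free E \<longleftrightarrow>
     (\<forall>vs. 4 \<le> length vs \<and> path_in E vs \<and> (hd vs, last vs) \<in> E \<longrightarrow> tournament_in E vs)"

lemma path_in_mono: "path_in E vs \<Longrightarrow> E \<subseteq> F \<Longrightarrow> path_in F vs"
  by (erule successively_mono) blast

lemma path_in_trancl_sorted:
  assumes "path_in E vs"
  shows "sorted_wrt (\<lambda>u v. (u, v) \<in> E\<^sup>+) vs"
proof -
  \<comment> \<open>Passing to the closure gives a transitive relation, for which consecutive pairs
    control all pairs.\<close>
  have "successively (\<lambda>u v. (u, v) \<in> E\<^sup>+) vs"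
    using assms by (rule successively_mono) blast
  then show ?thesis
    by (subst (asm) successively_conv_sorted_wrt) (auto simp: transp_def)
qed

lemma path_in_distinct:
  assumes "acyclic E" "path_in E vs"
  shows "distinct vs"
  using path_in_trancl_sorted[OF assms(2)] assms(1)
  by (induction vs) (auto simp: acyclic_def)

lemma path_in_hd_last:
  assumes "path_in E vs" "vs \<noteq> []"
  shows "(hd vs, last vs) \<in> E\<^sup>*"
  using assms by (induction vs rule: induct_list012) (auto intro: converse_rtrancl_into_rtrancl)

lemma path_in_set_Field:
  assumes "path_in E vs" "2 \<le> length vs"
  shows "set vs \<subseteq> Field E"
  using assms
proof (induction vs rule: induct_list012)
  case (3 u v vs)
  then show ?case by (cases vs) (auto simp: Field_def)
qed auto

text \<open>Serves to carry paths of a subdivided relation back to the original one: away from the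
  new vertex \<open>p\<close>, every arc is an old arc.\<close>

lemma path_in_avoid:
  assumes "path_in E vs" "\<And>u v. (u, v) \<in> E \<Longrightarrow> u \<noteq> p \<Longrightarrow> v \<noteq> p \<Longrightarrow> (u, v) \<in> F" "p \<notin> set vs"
  shows "path_in F vs"
  using assms(1) by (rule successively_mono) (use assms(2,3) in metis)

lemma tournament_in_total:
  assumes "tournament_in E vs" "u \<in> set vs" "v \<in> set vs" "u \<noteq> v"
  shows "(u, v) \<in> E \<or> (v, u) \<in> E"
  using assms by (induction vs) auto

lemma distinct_hd_neq_last:
  assumes "distinct xs" "2 \<le> length xs"
  shows "hd xs \<noteq> last xs"
  using assms by (cases xs) auto

lemma acyclic_asym: "acyclic E \<Longrightarrow> (u, v) \<in> E \<Longrightarrow> (v, u) \<notin> E"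
  by (meson acyclic_def r_into_trancl trancl_trans)

lemma acyclic_no_path_back: "acyclic E \<Longrightarrow> (u, v) \<in> E \<Longrightarrow> (v, u) \<notin> E\<^sup>*"
  by (meson acyclic_def rtrancl_into_trancl2)

text \<open>Some arc joins \<open>u\<close> and \<open>w\<close>, and an arc from \<open>w\<close>
  to \<open>u\<close> would close a directed cycle with \<open>u\<close>, \<open>v\<close>,
  \<open>w\<close>.\<close>

lemma tournament_in_trans:
  assumes "acyclic E" "tournament_in E vs" "u \<in> set vs" "w \<in> set vs" "(u, v) \<in> E" "(v, w) \<in> E"
  shows "(u, w) \<in> E"
proof -
  have "(u, w) \<in> E\<^sup>+" using assms(5,6) by auto
  then have "u \<noteq> w" "(w, u) \<notin> E"
    using assms(1) by (auto simp: acyclic_def dest: trancl_into_trancl)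
  then show ?thesis using tournament_in_total[OF assms(2,3,4)] by blast
qed

section \<open>Deleting an arc\<close>

lemma shortcut_freeD:
  assumes "shortcut_free E" "path_in E vs" "(hd vs, last vs) \<in> E" "4 \<le> length vs"
  shows "tournament_in E vs"
  using assms unfolding shortcut_free_def by blast

text \<open>The hypothesis \<open>no4\<close> is the form in which the absence of a K4 on the edge
  enters all the relational lemmas. Here it ensures that the tournament forced by a long path with a
  chord misses \<open>x\<close> or \<open>y\<close>, so that the deleted arc is none of its
  arcs.\<close>

lemma shortcut_free_remove_arc:
  assumes free: "shortcut_free E"
    and no4: "\<And>vs. tournament_in E vs \<Longrightarrow> x \<in> set vs \<Longrightarrow> y \<in> set vs \<Longrightarrow> length vs < 4"
  shows "shortcut_free (E - {(x, y)})"
  unfolding shortcut_free_def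
proof (intro allI impI, elim conjE)
  fix vs
  assume vs: "4 \<le> length vs" "path_in (E - {(x, y)}) vs" "(hd vs, last vs) \<in> E - {(x, y)}"
  have T: "tournament_in E vs"
    using vs path_in_mono[OF vs(2), of E] by (intro shortcut_freeD[OF free]) auto
  then have "\<not> (x \<in> set vs \<and> y \<in> set vs)" using no4[of vs] vs(1) by linarith
  then show "tournament_in (E - {(x, y)}) vs"
    using T by (auto intro: sorted_wrt_mono_rel[rotated])
qed

section \<open>Subdividing an arc by one new vertex\<close>

lemma acyclic_remove: "acyclic E \<Longrightarrow> acyclic (E - A)"
  by (rule acyclic_subset) auto

lemma rtrancl_no_out: "(p, v) \<in> E\<^sup>* \<Longrightarrow> p \<notin> Domain E \<Longrightarrow> v = p"
  by (auto elim: converse_rtranclE)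

text \<open>The two arcs are added one at a time. First \<open>p\<close> is isolated, so it does not
  reach \<open>x\<close>. Afterwards \<open>y\<close> could reach \<open>p\<close> only by way of
  \<open>x\<close>, and a path from \<open>y\<close> to \<open>x\<close> would form a cycle of
  \<open>E\<close> with the arc from \<open>x\<close> to \<open>y\<close>.\<close>

lemma acyclic_subdivide_path:
  assumes "acyclic E" "(x, y) \<in> E" "p \<notin> Field E"
  shows "acyclic (E - {(x, y)} \<union> {(x, p), (p, y)})"
proof -
  let ?F = "E - {(x, y)}"
  have xp: "x \<noteq> p" and yp: "y \<noteq> p" using assms by (auto simp: Field_def)
  have "p \<notin> Domain ?F" "p \<notin> Range ?F" using assms(3) by (auto simp: Field_def)
  moreover have "(y, x) \<notin> ?F\<^sup>*"
    using acyclic_no_path_back[OF assms(1,2)] rtrancl_mono[of ?F E] by auto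
  moreover have "(y, p) \<notin> ?F\<^sup>*"
    using yp \<open>p \<notin> Range ?F\<close> by (auto elim: rtranclE)
  ultimately have "(p, x) \<notin> ?F\<^sup>*" "(y, p) \<notin> (insert (x, p) ?F)\<^sup>*"
    using xp by (auto simp: rtrancl_insert dest: rtrancl_no_out)
  then have "acyclic (insert (p, y) (insert (x, p) ?F))"
    using acyclic_remove[OF assms(1)] by (simp add: acyclic_insert)
  moreover have "insert (p, y) (insert (x, p) ?F) = ?F \<union> {(x, p), (p, y)}" by auto
  ultimately show ?thesis by simp
qed

text \<open>At either insertion \<open>p\<close> has no outgoing arc, so the new arc into
  \<open>p\<close> lies on no cycle.\<close>

lemma acyclic_subdivide_sink:
  assumes "acyclic E" "p \<notin> Field E" "x \<noteq> p" "y \<noteq> p"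
  shows "acyclic (E - {(x, y)} \<union> {(x, p), (y, p)})"
proof -
  let ?F = "E - {(x, y)}"
  have "p \<notin> Domain ?F" "p \<notin> Domain (insert (x, p) ?F)"
    using assms(2,3) by (auto simp: Field_def)
  then have "(p, x) \<notin> ?F\<^sup>*" "(p, y) \<notin> (insert (x, p) ?F)\<^sup>*"
    using assms(3,4) rtrancl_no_out by metis+
  then have "acyclic (insert (y, p) (insert (x, p) ?F))"
    using acyclic_remove[OF assms(1)] by (simp add: acyclic_insert)
  moreover have "insert (y, p) (insert (x, p) ?F) = ?F \<union> {(x, p), (y, p)}" by auto
  ultimately show ?thesis by simp
qed

text \<open>The common part of both ways to orient the new edges: paths that avoid \<open>p\<close>
  are settled in \<open>F\<close>, which leaves only paths through \<open>p\<close>. The bound 3 in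
  \<open>no_p\<close> counts the vertices other than \<open>p\<close>.\<close>

lemma shortcut_free_new_vertex:
  assumes free: "shortcut_free F"
    and fresh: "\<And>u v. (u, v) \<in> F' \<Longrightarrow> u \<noteq> p \<Longrightarrow> v \<noteq> p \<Longrightarrow> (u, v) \<in> F" and sub: "F \<subseteq> F'"
    and no_p: "\<And>us ws. 3 \<le> length (us @ ws) \<Longrightarrow> path_in F' (us @ p # ws) \<Longrightarrow>
      (hd (us @ p # ws), last (us @ p # ws)) \<in> F' \<Longrightarrow> False"
  shows "shortcut_free F'"
  unfolding shortcut_free_def
proof (intro allI impI, elim conjE)
  fix vs
  assume vs: "4 \<le> length vs" "path_in F' vs" "(hd vs, last vs) \<in> F'"
  have p: "p \<notin> set vs"
  proof
    assume "p \<in> set vs"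
    then obtain us ws where "vs = us @ p # ws" by (meson split_list)
    then show False using vs no_p[of us ws] by auto
  qed
  have "vs \<noteq> []" using vs(1) by auto
  then have "hd vs \<noteq> p" "last vs \<noteq> p" using p hd_in_set last_in_set by metis+
  then have "(hd vs, last vs) \<in> F" using fresh vs(3) by blast
  then have "tournament_in F vs"
    using path_in_avoid[OF vs(2) fresh p] vs(1) by (intro shortcut_freeD[OF free]) auto
  then show "tournament_in F' vs" using sub by (auto intro: sorted_wrt_mono_rel[rotated])
qed

text \<open>A path with a chord that meets \<open>p\<close> has \<open>p\<close> in its interior,
  between \<open>x\<close> and \<open>y\<close>. Skipping \<open>p\<close> gives a path of
  \<open>E\<close> with the same chord and one vertex less. If this has four or more vertices,
  \<open>no4\<close> applies at once; if it has three, the detour through \<open>z\<close> restores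
  the fourth.\<close>

lemma shortcut_free_subdivide_path:
  assumes acyc: "acyclic E" and free: "shortcut_free E" and xy: "(x, y) \<in> E" and p: "p \<notin> Field E"
    and no4: "\<And>vs. tournament_in E vs \<Longrightarrow> x \<in> set vs \<Longrightarrow> y \<in> set vs \<Longrightarrow> length vs < 4"
    and z: "(x, z) \<in> E" "(z, y) \<in> E"
  shows "shortcut_free (E - {(x, y)} \<union> {(x, p), (p, y)})" (is "shortcut_free ?F'")
proof (rule shortcut_free_new_vertex[where p = p and F = "E - {(x, y)}"])
  show "shortcut_free (E - {(x, y)})" by (rule shortcut_free_remove_arc[OF free no4])
next
  have acyc': "acyclic ?F'" by (rule acyclic_subdivide_path[OF acyc xy p])
  have out: "v = y" if "(p, v) \<in> ?F'" for v using that p xy by (auto simp: Field_def)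
  have inn: "v = x" if "(v, p) \<in> ?F'" for v using that p xy by (auto simp: Field_def)
  fix us ws
  assume len: "3 \<le> length (us @ ws)" and path: "path_in ?F' (us @ p # ws)"
    and ends: "(hd (us @ p # ws), last (us @ p # ws)) \<in> ?F'"
  have dist: "distinct (us @ p # ws)" by (rule path_in_distinct[OF acyc' path])
  \<comment> \<open>If \<open>p\<close> came first, its only out-neighbour \<open>y\<close> would be
    both its successor and the end of the path.\<close>
  have us: "us \<noteq> []"
  proof
    assume us: "us = []"
    then have ws: "3 \<le> length ws" "ws \<noteq> []" using len by auto
    then have "(p, last ws) \<in> ?F'" "(p, hd ws) \<in> ?F'"
      using us path ends by (simp_all add: successively_Cons)
    then have "hd ws = last ws" using out by metis
    then show False using distinct_hd_neq_last[of ws] dist ws by simp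
  qed
  \<comment> \<open>Dually, \<open>x\<close> would be both the start of the path and the predecessor
    of \<open>p\<close>.\<close>
  have ws: "ws \<noteq> []"
  proof
    assume ws: "ws = []"
    then have "3 \<le> length us" using len by simp
    moreover have "(hd us, p) \<in> ?F'" "(last us, p) \<in> ?F'"
      using us ws path ends by (simp_all add: successively_append_iff)
    then have "hd us = last us" using inn by metis
    ultimately show False using distinct_hd_neq_last[of us] dist by simp
  qed
  have path3: "path_in ?F' us" "path_in ?F' ws" "(last us, p) \<in> ?F'" "(p, hd ws) \<in> ?F'"
    using path us ws by (simp_all add: successively_append_iff successively_Cons)
  have lu: "last us = x" and hw: "hd ws = y" using path3(3,4) out inn by metis+
  have pus: "path_in E us"
    by (rule path_in_avoid[OF path3(1), where p = p]) (use dist in auto)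
  have pws: "path_in E ws"
    by (rule path_in_avoid[OF path3(2), where p = p]) (use dist in auto)
  \<comment> \<open>The arc from \<open>x\<close> to \<open>y\<close> in \<open>E\<close> closes the
    gap left by \<open>p\<close>.\<close>
  have path': "path_in E (us @ ws)" using pus pws lu hw xy by (auto simp: successively_append_iff)
  have ends': "(hd us, last ws) \<in> E"
  proof -
    have "hd us \<noteq> p" "last ws \<noteq> p" using dist us ws by auto
    then show ?thesis using ends us ws by auto
  qed
  have xus: "x \<in> set us" and yws: "y \<in> set ws" using lu hw us ws by auto
  have "\<not> 4 \<le> length (us @ ws)"
  proof
    assume "4 \<le> length (us @ ws)"
    then have "tournament_in E (us @ ws)"
      using path' ends' us ws by (intro shortcut_freeD[OF free]) auto
    then show False using no4[of "us @ ws"] \<open>4 \<le> length (us @ ws)\<close> xus yws by auto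
  qed
  then have "length us + length ws = 3" using len by simp
  moreover have "length us \<noteq> 0" "length ws \<noteq> 0" using us ws by auto
  ultimately consider "length us = 1" "length ws = 2" | "length us = 2" "length ws = 1" by linarith
  then show False
  proof cases
    case 1
    then obtain w where "us = [x]" "ws = [y, w]"
      using lu hw by (auto simp: length_Suc_conv numeral_2_eq_2)
    \<comment> \<open>The arc from \<open>x\<close> to \<open>w\<close> is the chord
      \<open>ends'\<close>; replacing the step from \<open>x\<close> to \<open>y\<close> by the
      detour through \<open>z\<close> makes the path long enough for \<open>free\<close>.\<close>
    then have "tournament_in E [x, z, y, w]"
      using pws ends' z by (intro shortcut_freeD[OF free]) auto
    then show False using no4[of "[x, z, y, w]"] by simp
  next
    case 2
    then obtain w where "us = [w, x]" "ws = [y]"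
      using lu hw by (auto simp: length_Suc_conv numeral_2_eq_2)
    then have "tournament_in E [w, x, z, y]"
      using pus ends' z by (intro shortcut_freeD[OF free]) auto
    then show False using no4[of "[w, x, z, y]"] by simp
  qed
qed auto

text \<open>As a sink, \<open>p\<close> can only end a path. The start of the path and the
  predecessor of \<open>p\<close> are then in-neighbours of \<open>p\<close>, so they are
  \<open>x\<close> and \<open>y\<close>. Without \<open>p\<close>, what remains is a path from
  \<open>x\<close> to \<open>y\<close> in \<open>E\<close>, whose chord is the original arc.\<close>

lemma shortcut_free_subdivide_sink:
  assumes acyc: "acyclic E" and free: "shortcut_free E" and xy: "(x, y) \<in> E" and p: "p \<notin> Field E"
    and no4: "\<And>vs. tournament_in E vs \<Longrightarrow> x \<in> set vs \<Longrightarrow> y \<in> set vs \<Longrightarrow> length vs < 4"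
    and no_z: "\<And>z. (x, z) \<in> E \<Longrightarrow> (z, y) \<notin> E"
  shows "shortcut_free (E - {(x, y)} \<union> {(x, p), (y, p)})" (is "shortcut_free ?F'")
proof (rule shortcut_free_new_vertex[where p = p and F = "E - {(x, y)}"])
  show "shortcut_free (E - {(x, y)})" by (rule shortcut_free_remove_arc[OF free no4])
next
  have xp: "x \<noteq> p" and yp: "y \<noteq> p" using xy p by (auto simp: Field_def)
  have acyc': "acyclic ?F'" by (rule acyclic_subdivide_sink[OF acyc p xp yp])
  have out: "(p, v) \<notin> ?F'" for v using p xp yp by (auto simp: Field_def)
  have inn: "v = x \<or> v = y" if "(v, p) \<in> ?F'" for v using that p by (auto simp: Field_def)
  fix us ws
  assume len: "3 \<le> length (us @ ws)" and path: "path_in ?F' (us @ p # ws)"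
    and ends: "(hd (us @ p # ws), last (us @ p # ws)) \<in> ?F'"
  have dist: "distinct (us @ p # ws)" by (rule path_in_distinct[OF acyc' path])
  have "ws = []" using path out by (auto simp: successively_append_iff successively_Cons)
  then have us: "us \<noteq> []" "3 \<le> length us" using len by auto
  have lu: "last us = x \<or> last us = y" and hu: "hd us = x \<or> hd us = y"
    using path ends us inn \<open>ws = []\<close> by (auto simp: successively_append_iff)
  have ne: "hd us \<noteq> last us" using distinct_hd_neq_last[of us] dist us by simp
  have "path_in ?F' us" using path by (simp add: successively_append_iff)
  then have pus: "path_in E us"
    by (rule path_in_avoid[where p = p]) (use dist in auto)
  \<comment> \<open>This fixes the order of the two ends: a path from \<open>y\<close> to
    \<open>x\<close> would close a cycle with the arc from \<open>x\<close> to
    \<open>y\<close>.\<close>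
  have "(hd us, last us) \<in> E\<^sup>*" by (rule path_in_hd_last[OF pus us(1)])
  then have hx: "hd us = x" and ly: "last us = y"
    using ne hu lu acyclic_no_path_back[OF acyc xy] by auto
  have "\<not> 4 \<le> length us"
  proof
    assume "4 \<le> length us"
    then have "tournament_in E us"
      using pus hx ly xy by (intro shortcut_freeD[OF free]) auto
    moreover have "x \<in> set us" "y \<in> set us" using hx ly us by auto
    ultimately show False using no4[of us] \<open>4 \<le> length us\<close> by auto
  qed
  then have "length us = 3" using us by simp
  then obtain z where "us = [x, z, y]"
    using hx ly by (auto simp: length_Suc_conv numeral_3_eq_3)
  then show False using pus no_z by auto
qed auto

section \<open>Semi-transitive orientations as relations\<close>

lemma vwalk_arcs_subset_iff: "set (vwalk_arcs vs) \<subseteq> E \<longleftrightarrow> path_in E vs"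
  by (induction vs rule: vwalk_arcs.induct) auto

text \<open>A pair (u, u) in the transitive closure yields only a closed walk, which may repeat
  vertices; every nonempty closed walk contains a cycle.\<close>

lemma (in pair_wf_digraph) ex_cycle_iff: "(\<exists>p. cycle p) \<longleftrightarrow> \<not> acyclic (parcs G)"
proof
  assume "\<exists>p. cycle p"
  then obtain u p where "awalk u p u" "p \<noteq> []" by (auto simp: cycle_def)
  then have "(u, u) \<in> (parcs G)\<^sup>+" by (auto simp: reachable1_awalk)
  then show "\<not> acyclic (parcs G)" by (auto simp: acyclic_def)
next
  assume "\<not> acyclic (parcs G)"
  then obtain u where "(u, u) \<in> (parcs G)\<^sup>+" by (auto simp: acyclic_def)
  then obtain p where "awalk u p u" "p \<noteq> []" by (auto simp: reachable1_awalk)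
  then have "closed_w p" by (auto simp: closed_w_def)
  then show "\<exists>p. cycle p" by (rule closed_w_imp_cycle)
qed

text \<open>On the vertices of a path, transitivity extends consecutive arcs to all forward pairs;
  conversely, a tournament within an acyclic relation is transitive.\<close>

lemma ex_shortcut_iff:
  fixes D :: "'a pair_pre_digraph"
  assumes wf: "pair_wf_digraph D" and acyc: "acyclic (parcs D)"
  shows "(\<exists>S. shortcut S D) \<longleftrightarrow> \<not> shortcut_free (parcs D)"
proof
  assume "\<exists>S. shortcut S D"
  then obtain S :: "'a pair_pre_digraph" and vs where S: "induced_subgraph S D" "\<not> transitive_digraph S"
    and vs: "4 \<le> length vs" "pverts S = set vs" "vpath vs S" "hd vs \<rightarrow>\<^bsub>S\<^esub> last vs"
    unfolding shortcut_def by blast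
  have arcs: "parcs S = {a \<in> parcs D. fst a \<in> set vs \<and> snd a \<in> set vs}"
    using S(1) vs(2) by (auto simp: induced_subgraph_def)
  show "\<not> shortcut_free (parcs D)"
  proof
    assume free: "shortcut_free (parcs D)"
    have "path_in (parcs S) vs"
      using vs(3) by (auto simp: vpath_def vwalk_def simp flip: vwalk_arcs_subset_iff)
    then have "path_in (parcs D) vs" using arcs by (auto intro: path_in_mono)
    moreover have "(hd vs, last vs) \<in> parcs D" using vs(4) arcs by auto
    ultimately have "tournament_in (parcs D) vs" using vs(1) by (intro shortcut_freeD[OF free])
    then have "transitive_digraph S"
      unfolding transitive_digraph_def using tournament_in_trans[OF acyc] arcs by auto
    with S(2) show False by contradiction
  qed
next
  assume "\<not> shortcut_free (parcs D)"
  then obtain vs where vs: "4 \<le> length vs" "path_in (parcs D) vs" "(hd vs, last vs) \<in> parcs D"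
    and nt: "\<not> tournament_in (parcs D) vs"
    unfolding shortcut_free_def by blast
  interpret pair_wf_digraph D by (rule wf)
  have "set vs \<subseteq> Field (parcs D)" using path_in_set_Field[OF vs(2)] vs(1) by simp
  then have verts: "set vs \<subseteq> pverts D" by (auto simp: Field_def dest: in_arcsD1 in_arcsD2)
  define S where
    "S = \<lparr> pverts = set vs, parcs = {a \<in> parcs D. fst a \<in> set vs \<and> snd a \<in> set vs} \<rparr>"
  have "pair_wf_digraph S" by unfold_locales (auto simp: S_def)
  then have "induced_subgraph S D"
    using verts wf
    by (auto simp: induced_subgraph_def subgraph_def compatible_def wf_digraph_wp_iff S_def)
  moreover have "\<not> transitive_digraph S"
  proof
    assume T: "transitive_digraph S"
    \<comment> \<open>\<open>transitive_digraph\<close> speaks of distinct triples only; acyclicity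
      makes any two composable arcs span such a triple.\<close>
    have "(u, w) \<in> parcs D"
      if "u \<in> set vs" "v \<in> set vs" "w \<in> set vs" "(u, v) \<in> parcs D" "(v, w) \<in> parcs D" for u v w
    proof -
      have "u \<noteq> v" "v \<noteq> w" "u \<noteq> w"
        using acyclic_asym[OF acyc that(4)] acyclic_asym[OF acyc that(5)] that(4,5) by blast+
      then have "distinct [u, v, w]" by simp
      moreover have "u \<rightarrow>\<^bsub>S\<^esub> v" "v \<rightarrow>\<^bsub>S\<^esub> w" using that by (simp_all add: S_def)
      ultimately have "u \<rightarrow>\<^bsub>S\<^esub> w" using T unfolding transitive_digraph_def by blast
      then show ?thesis by (simp add: S_def)
    qed
    then have "path_in (parcs D) vs \<longleftrightarrow> tournament_in (parcs D) vs"
      by (intro successively_iff_sorted_wrt_strong)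
    then have "tournament_in (parcs D) vs" using vs(2) by simp
    with nt show False by contradiction
  qed
  moreover have "path_in (parcs S) vs"
    using vs(2) by (rule successively_mono) (auto simp: S_def)
  then have "vpath vs S"
    using vs(1) path_in_distinct[OF acyc vs(2)]
    by (auto simp: vpath_def vwalk_def S_def vwalk_arcs_subset_iff)
  moreover have "hd vs \<rightarrow>\<^bsub>S\<^esub> last vs"
    using vs(1,3) hd_in_set[of vs] last_in_set[of vs] by (fastforce simp: S_def)
  ultimately have "shortcut S D"
    unfolding shortcut_def using vs(1) by (auto simp: S_def)
  then show "\<exists>S. shortcut S D" ..
qed

text \<open>An orientation amounts to its arc set \<open>E\<close>: the symmetric closure recovers
  the graph, and acyclicity already forbids both directions of one edge.\<close>

lemma (in pair_graph) semi_transitively_orientable_iff: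
  "semi_transitively_orientable G \<longleftrightarrow>
    (\<exists>E. acyclic E \<and> shortcut_free E \<and> parcs G = E \<union> E\<inverse>)"
proof
  assume "semi_transitively_orientable G"
  then obtain D where D: "orientation D G" "\<not> (\<exists>p. pre_digraph.cycle D p)" "\<not> (\<exists>S. shortcut S D)"
    by (auto simp: semi_transitively_orientable_def semi_transitive_orientation_def
        acyclic_orientation_def)
  have "pverts D = pverts G" "\<And>a. a \<in> parcs D \<Longrightarrow> a \<in> parcs G"
    using D(1) by (auto simp: orientation_def)
  then have wf: "pair_wf_digraph D"
    by unfold_locales (simp_all add: arc_fst_in_verts arc_snd_in_verts)
  have acyc: "acyclic (parcs D)" using pair_wf_digraph.ex_cycle_iff[OF wf] D(2) by simp
  moreover have "shortcut_free (parcs D)" using ex_shortcut_iff[OF wf acyc] D(3) by simp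
  moreover have "(u, v) \<in> parcs G \<longleftrightarrow> (u, v) \<in> parcs D \<or> (v, u) \<in> parcs D" for u v
    using D(1) arcs_symmetric unfolding orientation_def by blast
  then have "parcs G = parcs D \<union> (parcs D)\<inverse>" by auto
  ultimately show "\<exists>E. acyclic E \<and> shortcut_free E \<and> parcs G = E \<union> E\<inverse>" by blast
next
  assume "\<exists>E. acyclic E \<and> shortcut_free E \<and> parcs G = E \<union> E\<inverse>"
  then obtain E where E: "acyclic E" "shortcut_free E" "parcs G = E \<union> E\<inverse>" by blast
  define D where "D = \<lparr> pverts = pverts G, parcs = E \<rparr>"
  have [simp]: "parcs D = E" by (simp add: D_def)
  have wf: "pair_wf_digraph D"
    using E(3) by unfold_locales (auto simp: D_def dest: wellformed')
  have "orientation D G"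
    using E(3) acyclic_asym[OF E(1)] by (auto simp: orientation_def D_def)
  moreover have "\<not> (\<exists>p. pre_digraph.cycle D p)"
    using pair_wf_digraph.ex_cycle_iff[OF wf] E(1) by simp
  moreover have "\<not> (\<exists>S. shortcut S D)" using ex_shortcut_iff[OF wf] E(1,2) by simp
  ultimately show "semi_transitively_orientable G"
    by (auto simp: semi_transitively_orientable_def semi_transitive_orientation_def
        acyclic_orientation_def)
qed

section \<open>Deleting and subdividing an edge\<close>

text \<open>Stated for a bare relation and a vertex set, so that it applies to the symmetric closure
  of an orientation and to subdivided graphs without constructing a subgraph.\<close>

definition in_K4 :: "'a rel \<Rightarrow> 'a \<Rightarrow> 'a \<Rightarrow> bool" where
  "in_K4 R x y \<longleftrightarrow>
     (\<exists>K. card K = 4 \<and> x \<in> K \<and> y \<in> K \<and> (\<forall>u\<in>K. \<forall>v\<in>K. u \<noteq> v \<longrightarrow> (u, v) \<in> R))"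

lemma in_K4_commute: "in_K4 R x y \<longleftrightarrow> in_K4 R y x"
  by (auto simp: in_K4_def)

lemma (in pair_graph) in_K4_subgraph:
  assumes "in_K4 (parcs G) x y" "x \<noteq> y"
  shows "\<exists>K. subgraph K (with_proj G) \<and> complete_digraph 4 K \<and> (x, y) \<in> arcs K"
proof -
  obtain A where A: "card A = 4" "x \<in> A" "y \<in> A" "\<And>u v. u \<in> A \<Longrightarrow> v \<in> A \<Longrightarrow> u \<noteq> v \<Longrightarrow> (u, v) \<in> parcs G"
    using assms(1) unfolding in_K4_def by blast
  define K where "K = \<lparr> pverts = A, parcs = {(u, v). (u, v) \<in> A \<times> A \<and> u \<noteq> v} \<rparr>"
  have fin: "finite A" using A(1) by (simp add: card_ge_0_finite)
  \<comment> \<open>Membership in the graph comes from an arc to another vertex of \<open>A\<close>;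
    one of the distinct vertices \<open>x\<close> and \<open>y\<close> supplies it.\<close>
  have "A \<subseteq> pverts G"
  proof
    fix u assume u: "u \<in> A"
    obtain v where "v \<in> A" "u \<noteq> v" using A(2,3) assms(2) by metis
    then show "u \<in> pverts G" using A(4) u in_arcsD1 by blast
  qed
  moreover have "pair_wf_digraph K" by unfold_locales (auto simp: K_def)
  moreover have "pair_wf_digraph G" ..
  ultimately have "subgraph K (with_proj G)"
    using A(4) by (auto simp: subgraph_def compatible_def wf_digraph_wp_iff K_def)
  moreover have "complete_digraph 4 K"
    unfolding complete_digraph_pair_def using fin A(1) by (simp add: K_def)
  moreover have "(x, y) \<in> arcs K" using A(2,3) assms(2) by (simp add: K_def)
  ultimately show ?thesis by blast
qed

text \<open>Otherwise \<open>x\<close>, \<open>y\<close> and two further vertices of the tournament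
  would form a K4 on the edge.\<close>

lemma tournament_in_length_less_4:
  assumes "acyclic E" "\<not> in_K4 (E \<union> E\<inverse>) x y" "(x, y) \<in> E"
    and vs: "tournament_in E vs" "x \<in> set vs" "y \<in> set vs"
  shows "length vs < 4"
proof (rule ccontr)
  assume "\<not> length vs < 4"
  moreover have "distinct vs"
    using path_in_distinct[OF assms(1) successively_if_sorted_wrt[OF vs(1)]] .
  ultimately have "4 \<le> card (set vs)" by (simp add: distinct_card)
  moreover have "card {x, y} \<le> 4" by (simp add: card_insert_if)
  ultimately obtain K where K: "{x, y} \<subseteq> K" "K \<subseteq> set vs" "card K = 4"
    using exists_subset_between[of "{x, y}" 4 "set vs"] vs(2,3) by auto
  have "(u, v) \<in> E \<union> E\<inverse>" if "u \<in> K" "v \<in> K" "u \<noteq> v" for u v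
    using tournament_in_total[OF vs(1)] that K(2) by blast
  then have "in_K4 (E \<union> E\<inverse>) x y"
    unfolding in_K4_def by (intro exI[of _ K]) (use K in auto)
  with assms(2) show False by contradiction
qed

text \<open>The pair (a, b) names the edge in an arbitrary direction, while (x, y) is its direction
  in the chosen orientation.\<close>

lemma semi_transitive_arc_cases:
  assumes "pair_graph G" "semi_transitively_orientable G" "(a, b) \<in> parcs G"
    "\<not> in_K4 (parcs G) a b"
  obtains E x y where "acyclic E" "shortcut_free E" "parcs G = E \<union> E\<inverse>" "(x, y) \<in> E"
    "(x, y) = (a, b) \<or> (x, y) = (b, a)"
    "\<And>vs. tournament_in E vs \<Longrightarrow> x \<in> set vs \<Longrightarrow> y \<in> set vs \<Longrightarrow> length vs < 4"
proof -
  obtain E where E: "acyclic E" "shortcut_free E" "parcs G = E \<union> E\<inverse>"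
    using assms(2) pair_graph.semi_transitively_orientable_iff[OF assms(1)] by blast
  have "(a, b) \<in> E \<or> (b, a) \<in> E" using assms(3) E(3) by auto
  then obtain x y where xy: "(x, y) \<in> E" "(x, y) = (a, b) \<or> (x, y) = (b, a)" by blast
  then have "\<not> in_K4 (E \<union> E\<inverse>) x y" using assms(4) in_K4_commute[of _ a b] E(3) by auto
  then show thesis
    using that[OF E xy] tournament_in_length_less_4[OF E(1) _ xy(1)] by blast
qed

section \<open>Deleting the edge\<close>

lemma pair_graph_delete_edge:
  assumes "pair_graph G"
  shows "pair_graph (delete_edge G e)"
proof -
  interpret pair_graph G by (rule assms)
  show ?thesis
    by unfold_locales
      (auto simp: delete_edge_def symmetric_def sym_def dest: wellformed' no_loops' arcs_symmetric)
qed

lemma semi_transitively_orientable_delete_edge: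
  assumes G: "pair_graph G" "semi_transitively_orientable G" "(a, b) \<in> parcs G"
    "\<not> in_K4 (parcs G) a b"
  shows "semi_transitively_orientable (delete_edge G (a, b))"
proof -
  obtain E x y where E: "acyclic E" "shortcut_free E" "parcs G = E \<union> E\<inverse>" "(x, y) \<in> E"
    and ab: "(x, y) = (a, b) \<or> (x, y) = (b, a)"
    and no4: "\<And>vs. tournament_in E vs \<Longrightarrow> x \<in> set vs \<Longrightarrow> y \<in> set vs \<Longrightarrow> length vs < 4"
    using semi_transitive_arc_cases[OF G] by blast
  let ?F = "E - {(x, y)}"
  \<comment> \<open>Since (y, x) is not in \<open>E\<close>, dropping the single arc (x, y) removes
    both directions from the symmetric closure.\<close>
  have "parcs (delete_edge G (a, b)) = ?F \<union> ?F\<inverse>"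
    using ab E(3) acyclic_asym[OF E(1,4)] by (auto simp: delete_edge_def)
  then show ?thesis
    unfolding pair_graph.semi_transitively_orientable_iff[OF pair_graph_delete_edge[OF G(1)]]
    by (intro exI[of _ ?F] conjI acyclic_remove[OF E(1)] shortcut_free_remove_arc[OF E(2) no4])
qed

section \<open>Subdividing the edge\<close>

definition subdivide_once :: "'a pair_pre_digraph \<Rightarrow> 'a \<Rightarrow> 'a \<Rightarrow> 'a \<Rightarrow> 'a pair_pre_digraph" where
  "subdivide_once G a b p = \<lparr> pverts = insert p (pverts G),
     parcs = parcs (delete_edge G (a, b)) \<union> {(a, p), (p, a), (p, b), (b, p)} \<rparr>"

lemma pair_graph_subdivide_once:
  assumes "pair_graph G" "(a, b) \<in> parcs G" "p \<notin> pverts G"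
  shows "pair_graph (subdivide_once G a b p)"
proof -
  interpret pair_graph G by (rule assms(1))
  have "a \<in> pverts G" "b \<in> pverts G" using assms(2) by (auto dest: wellformed')
  then show ?thesis
    using assms(3)
    by unfold_locales
      (auto simp: subdivide_once_def delete_edge_def symmetric_def sym_def
        dest: wellformed' no_loops' arcs_symmetric)
qed

lemma semi_transitively_orientable_subdivide_once:
  assumes G: "pair_graph G" "semi_transitively_orientable G" "(a, b) \<in> parcs G"
    "\<not> in_K4 (parcs G) a b" and p: "p \<notin> pverts G"
  shows "semi_transitively_orientable (subdivide_once G a b p)"
proof -
  interpret pair_graph G by (rule G(1))
  obtain E x y where E: "acyclic E" "shortcut_free E" "parcs G = E \<union> E\<inverse>" "(x, y) \<in> E"
    and ab: "(x, y) = (a, b) \<or> (x, y) = (b, a)"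
    and no4: "\<And>vs. tournament_in E vs \<Longrightarrow> x \<in> set vs \<Longrightarrow> y \<in> set vs \<Longrightarrow> length vs < 4"
    using semi_transitive_arc_cases[OF G] by blast
  have pE: "p \<notin> Field E"
    using p E(3) by (auto simp: Field_def dest: wellformed')
  have "x \<noteq> p" "y \<noteq> p" using pE E(4) by (auto simp: Field_def)
  let ?F = "E - {(x, y)}"
  have del: "parcs (delete_edge G (a, b)) = ?F \<union> ?F\<inverse>"
    using ab E(3) acyclic_asym[OF E(1,4)] by (auto simp: delete_edge_def)
  have "\<exists>E'. acyclic E' \<and> shortcut_free E' \<and> parcs (subdivide_once G a b p) = E' \<union> E'\<inverse>"
  proof (cases "\<exists>z. (x, z) \<in> E \<and> (z, y) \<in> E")
    case True
    then obtain z where "(x, z) \<in> E" "(z, y) \<in> E" by blast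
    then have "shortcut_free (?F \<union> {(x, p), (p, y)})"
      by (intro shortcut_free_subdivide_path[OF E(1,2,4) pE no4])
    moreover have "acyclic (?F \<union> {(x, p), (p, y)})"
      by (rule acyclic_subdivide_path[OF E(1,4) pE])
    moreover have "parcs (subdivide_once G a b p)
        = (?F \<union> {(x, p), (p, y)}) \<union> (?F \<union> {(x, p), (p, y)})\<inverse>"
      using ab by (auto simp: subdivide_once_def del)
    ultimately show ?thesis by blast
  next
    case False
    then have "shortcut_free (?F \<union> {(x, p), (y, p)})"
      by (intro shortcut_free_subdivide_sink[OF E(1,2,4) pE no4]) auto
    moreover have "acyclic (?F \<union> {(x, p), (y, p)})"
      by (rule acyclic_subdivide_sink[OF E(1) pE \<open>x \<noteq> p\<close> \<open>y \<noteq> p\<close>])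
    moreover have "parcs (subdivide_once G a b p)
        = (?F \<union> {(x, p), (y, p)}) \<union> (?F \<union> {(x, p), (y, p)})\<inverse>"
      using ab by (auto simp: subdivide_once_def del)
    ultimately show ?thesis by blast
  qed
  then show ?thesis
    unfolding pair_graph.semi_transitively_orientable_iff[OF pair_graph_subdivide_once[OF G(1,3) p]] .
qed

text \<open>The new vertex has no neighbours besides \<open>a\<close> and \<open>b\<close>, so a
  clique through it has at most three vertices. This provides the K4 hypothesis for the next
  subdivision.\<close>

lemma in_K4_subdivide_once:
  assumes "pair_graph G" "p \<notin> pverts G"
  shows "\<not> in_K4 (parcs (subdivide_once G a b p)) p b"
proof
  interpret pair_graph G by (rule assms(1))
  assume "in_K4 (parcs (subdivide_once G a b p)) p b"
  then obtain K where K: "card K = 4" "p \<in> K"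
    "\<And>u v. u \<in> K \<Longrightarrow> v \<in> K \<Longrightarrow> u \<noteq> v \<Longrightarrow> (u, v) \<in> parcs (subdivide_once G a b p)"
    unfolding in_K4_def by blast
  have "K \<subseteq> {p, a, b}"
  proof
    fix v assume "v \<in> K"
    then have "v = p \<or> (p, v) \<in> parcs (subdivide_once G a b p)" using K by blast
    then show "v \<in> {p, a, b}"
      using assms(2) by (auto simp: subdivide_once_def delete_edge_def dest: wellformed')
  qed
  then have "card K \<le> card {p, a, b}" by (intro card_mono) auto
  also have "\<dots> \<le> 3" by (simp add: card_insert_if)
  finally show False using K(1) by simp
qed

text \<open>Inner vertices are inserted from the \<open>a\<close> end, and the rest of the list
  subdivides the edge from \<open>p\<close> to \<open>b\<close> of the new graph. Hence the
  induction varies \<open>G\<close> and \<open>a\<close> and keeps \<open>b\<close> fixed.\<close>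

lemma semi_transitively_orientable_subdivide:
  fixes G :: "'a pair_pre_digraph"
  assumes "pair_graph G" "semi_transitively_orientable G" "(a, b) \<in> parcs G"
    "\<not> in_K4 (parcs G) a b" "ps \<noteq> []" "distinct ps" "set ps \<inter> pverts G = {}"
  shows "semi_transitively_orientable
    \<lparr> pverts = pverts G \<union> set ps,
      parcs = parcs (delete_edge G (a, b)) \<union> set (vwalk_arcs (a # ps @ [b]))
        \<union> (set (vwalk_arcs (a # ps @ [b])))\<inverse> \<rparr>"
  using assms
proof (induction ps arbitrary: G a)
  case (Cons p ps)
  interpret pair_graph G by (rule Cons.prems(1))
  have p: "p \<notin> pverts G" using Cons.prems(7) by auto
  let ?H = "subdivide_once G a b p"
  have H: "pair_graph ?H" "semi_transitively_orientable ?H" "(p, b) \<in> parcs ?H"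
    "\<not> in_K4 (parcs ?H) p b"
    using pair_graph_subdivide_once[OF Cons.prems(1,3) p]
      semi_transitively_orientable_subdivide_once[OF Cons.prems(1-4) p]
      in_K4_subdivide_once[OF Cons.prems(1) p]
    by (auto simp: subdivide_once_def)
  have ab: "a \<in> pverts G" "b \<in> pverts G" using Cons.prems(3) by (auto dest: wellformed')
  show ?case
  proof (cases "ps = []")
    case True
    then have "\<lparr> pverts = pverts G \<union> set (p # ps),
      parcs = parcs (delete_edge G (a, b)) \<union> set (vwalk_arcs (a # (p # ps) @ [b]))
        \<union> (set (vwalk_arcs (a # (p # ps) @ [b])))\<inverse> \<rparr> = ?H"
      by (auto simp: subdivide_once_def)
    then show ?thesis using H(2) by simp
  next
    case False
    let ?P = "set (vwalk_arcs (p # ps @ [b]))"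
    have "set ps \<inter> pverts ?H = {}" using Cons.prems(6,7) by (auto simp: subdivide_once_def)
    then have "semi_transitively_orientable
        \<lparr> pverts = pverts ?H \<union> set ps, parcs = parcs (delete_edge ?H (p, b)) \<union> ?P \<union> ?P\<inverse> \<rparr>"
      using Cons.IH[OF H False] Cons.prems(6) by simp
    \<comment> \<open>No old arc is lost because \<open>p\<close> is new, and the edge from
      \<open>a\<close> to \<open>p\<close> survives because \<open>a\<close> and \<open>b\<close>
      differ.\<close>
    moreover have "parcs (delete_edge ?H (p, b)) = parcs (delete_edge G (a, b)) \<union> {(a, p), (p, a)}"
      using p ab no_loops'[OF Cons.prems(3)]
      by (auto simp: subdivide_once_def delete_edge_def dest: wellformed')
    moreover have "set (vwalk_arcs (a # (p # ps) @ [b])) = insert (a, p) ?P" by simp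
    moreover have "pverts ?H \<union> set ps = pverts G \<union> set (p # ps)"
      by (simp add: subdivide_once_def)
    moreover have "parcs (delete_edge G (a, b)) \<union> {(a, p), (p, a)} \<union> ?P \<union> ?P\<inverse>
        = parcs (delete_edge G (a, b)) \<union> insert (a, p) ?P \<union> (insert (a, p) ?P)\<inverse>"
      by blast
    ultimately show ?thesis by metis
  qed
qed simp

theorem theorem1p12:
  fixes G :: "'a pair_pre_digraph" and e :: "'a \<times> 'a"
  assumes "pair_graph G"
    and "semi_transitively_orientable G"
    and "e \<in> parcs G"
    and "\<not> (\<exists>K. subgraph K (with_proj G) \<and> complete_digraph 4 K \<and> e \<in> arcs K)"
  shows "semi_transitively_orientable (delete_edge G e) \<and>
    (\<forall>H. subdivides_edge G e H \<longrightarrow> semi_transitively_orientable H)"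
proof -
  interpret pair_graph G by (rule assms(1))
  obtain a b where e: "e = (a, b)" by fastforce
  then have ab: "(a, b) \<in> parcs G" using assms(3) by simp
  have K4: "\<not> in_K4 (parcs G) a b"
    using in_K4_subgraph no_loops'[OF ab] assms(4) unfolding e by blast
  have "semi_transitively_orientable H" if "subdivides_edge G e H" for H
    using that semi_transitively_orientable_subdivide[OF assms(1,2) ab K4]
    unfolding subdivides_edge_def e Let_def by auto
  then show ?thesis
    using semi_transitively_orientable_delete_edge[OF assms(1,2) ab K4] unfolding e by blast
qed

end
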